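(* In the setting fixed in the context (1-2 junction problem with fixed $T$, $n$, $v_j$, $a$, $\eta_0$, $\Phi$, $A^j_{hk}$), let $\{\{\boldsymbol{\varphi}^r\}_{r=1}^{3},\,\bar{\mathbf f}^1,\,\{\bar\Phi^r_f\}_{r=1}^{3}\}$ and $\{\{\boldsymbol{\phi}^r\}_{r=1}^{3},\,\bar{\mathbf g}^1,\,\{\bar\Phi^r_g\}_{r=1}^{3}\}$ be two sets of initial and boundary data for the 1-2 junction and let $\mathbf F_1,\mathbf G_1\in\mathcal B^3$ be two corresponding mild kinetic solutions across the 1-2 junction. Then there exists $\mathcal C>0$ such that $$\Vert \mathbf G_1-\mathbf F_1\Vert_\infty\leq \mathcal C\left[\sum_{r=1}^{3}\Vert\boldsymbol{\phi}^r-\boldsymbol{\varphi}^r\Vert_1+\int_0^T\left(\sum_{r=1}^{3}\left|\bar\Phi^r_g(t)-\bar\Phi^r_f(t)\right|+\Vert\bar{\mathbf g}^1(t)-\bar{\mathbf f}^1(t)\Vert_1\right)dt\right].$$ In particular, there is at most one mild kinetic solution across the 1-2 junction corresponding to a given set of initial and boundary data.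
   Context: Fixed quantities: $T>0$; an integer $n\ge 2$; speeds $0=v_1<v_2<\dots<v_n=1$; $a\in[0,1]$ (flux distribution coefficient); $\eta_0>0$. Put $\delta^c_{1j}=0$ if $j=1$ and $\delta^c_{1j}=1$ if $j\ge2$. Function spaces. $X_T=C([0,T];\mathbb R^n)$ and $$\mathcal B=\Big\{\mathbf u\in X_T:\ 0\le u_j(t)\le1,\ \sum_{j=1}^n u_j(t)\le 1\ \ \forall j=1,\dots,n,\ \forall t\in[0,T]\Big\}.$$ A constant vector is regarded as a constant function when membership in $\mathcal B$ is asserted. For $\mathbf U=(\mathbf u^1,\mathbf u^2,\mathbf u^3)\in\mathcal B^3$, $\Vert\mathbf U\Vert_\infty=\sup_{t\in[0,T]}\sum_{r=1}^3\sum_{j=1}^n|u^r_j(t)|$; $\Vert\cdot\Vert_1$ is the 1-norm on $\mathbb R^n$. Table of games. For $h,k,j\in\{1,\dots,n\}$ and $\rho\in[0,1]$, $A^j_{hk}[\rho]\geq 0$ are given probabilities with $\sum_{j=1}^nA^j_{hk}[\rho]=1$ for all $h,k,\rho$, and each $\rho\mapsto A^j_{hk}[\rho]$ is Lipschitz continuous on $[0,1]$. For $\mathbf f=(f_1,\dots,f_n)$ with $\rho=\sum_{j}f_j$, $$G_j[\mathbf f,\mathbf f]=\eta_0\,\rho\sum_{h,k=1}^nA^j_{hk}[\rho]f_hf_k,\qquad L[\mathbf f]=\eta_0\,\rho^2 .$$ Flux limiter. $\Phi:[0,1]^2\to[0,1]$ satisfies: (i) $0\le\Phi(u,v)\le1$;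 (ii) $\Phi(u,v)u\le1-v$ whenever $u+v>1$; (iii) there is $\mathrm{Lip}(\Phi)>0$ with $|\Phi(u_2,v_2)-\Phi(u_1,v_1)|\le\mathrm{Lip}(\Phi)(|u_2-u_1|+|v_2-v_1|)$ for all $(u_1,v_1),(u_2,v_2)\in[0,1]^2$. Data. A set of initial and boundary data is $\{\{\boldsymbol\varphi^r\}_{r=1}^3,\bar{\mathbf f}^1,\{\bar\Phi^r\}_{r=1}^3\}$, where $\boldsymbol\varphi^r=(\varphi^r_1,\dots,\varphi^r_n)\in\mathcal B$ are constant vectors, $\bar{\mathbf f}^1=(\bar f^1_1,\dots,\bar f^1_n)\in\mathcal B$, $\bar\Phi^2,\bar\Phi^3:[0,T]\to[0,1]$ are measurable, and $\bar\Phi^1(t)=\Phi(\bar\rho^1(t),\rho^1_1(t))$ with $\bar\rho^1=\sum_{j}\bar f^1_j$ and $\rho^1_1=\sum_jf^1_{1j}$ the density on road 1 of the solution under consideration. (The subscripts $f$, $g$ on $\bar\Phi^r$ indicate which of the two sets of data / solutions they refer to.) Mild solution. A function $\mathbf F_1=(\mathbf f^1_1,\mathbf f^2_1,\mathbf f^3_1):[0,T]\to\mathbb R^n\times\mathbb R^n\times\mathbb R^n$, $\mathbf f^r_1=(f^r_{1j})_{j=1}^n$, is a mild kinetic solution across the 1-2 junction if $\mathbf F_1\in\mathcal B^3$ and for all $t\in[0,T]$, $j=1,\dots,n$, $$f^1_{1j}(t)=\varphi^1_j+\int_0^t\Big\{v_j\big(\bar\Phi^1\bar f^1_j-(a\Phi^2_{0,1}+(1-a)\Phi^3_{0,1})f^1_{1j}\big)+G_j[\mathbf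 f^1_1,\mathbf f^1_1]-f^1_{1j}L[\mathbf f^1_1]\Big\}ds,$$ $$f^2_{1j}(t)=\varphi^2_j+\int_0^t\Big\{v_j\big(a\Phi^2_{0,1}f^1_{1j}\delta^c_{1j}-\bar\Phi^2f^2_{1j}\big)+G_j[\mathbf f^2_1,\mathbf f^2_1]-f^2_{1j}L[\mathbf f^2_1]\Big\}ds,$$ $$f^3_{1j}(t)=\varphi^3_j+\int_0^t\Big\{v_j\big((1-a)\Phi^3_{0,1}f^1_{1j}\delta^c_{1j}-\bar\Phi^3f^3_{1j}\big)+G_j[\mathbf f^3_1,\mathbf f^3_1]-f^3_{1j}L[\mathbf f^3_1]\Big\}ds,$$ all functions in the integrands being evaluated at time $s$, where $\Phi^r_{0,1}=\Phi(\rho^r_0,\rho^r_1)$ for $r=2,3$, $\rho^r_1=\sum_{j=1}^nf^r_{1j}$, $\rho^2_0=a\sum_{j=2}^nf^1_{1j}$ and $\rho^3_0=(1-a)\sum_{j=2}^nf^1_{1j}$. *)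

theory Defs
  imports "HOL-Analysis.Analysis"
begin

text \<open>
  The speed classes \<open>1, \<dots>, n\<close> are the elements of a finite linearly ordered type \<open>'n\<close>, with
  \<open>n = CARD('n)\<close>; class \<open>1\<close> is the least element and class \<open>n\<close> the greatest one.
  The three roads are indexed by the type \<^typ>\<open>3\<close> (elements \<open>1\<close>, \<open>2\<close> and \<open>3 = 0\<close>), so that a
  triple of vectors is an element of \<open>(real ^ 'n) ^ 3\<close>.
\<close>

definition first_class :: "'n :: {finite,linorder}" where
  "first_class = Min UNIV"

definition last_class :: "'n :: {finite,linorder}" where
  "last_class = Max UNIV"

definition delta_c :: "'n :: {finite,linorder} \<Rightarrow> real" where
  "delta_c j = (if j = first_class then 0 else 1)"

definition speeds :: "('n :: {finite,linorder} \<Rightarrow> real) \<Rightarrow> bool" where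
  "speeds v \<longleftrightarrow> strict_mono v \<and> v first_class = 0 \<and> v last_class = 1"

definition density :: "real ^ 'n :: finite \<Rightarrow> real" where
  "density f = (\<Sum>j\<in>UNIV. f $ j)"

definition norm1 :: "real ^ 'n :: finite \<Rightarrow> real" where
  "norm1 x = (\<Sum>j\<in>UNIV. \<bar>x $ j\<bar>)"

text \<open>The set \<open>\<B>\<close>. Only the values on \<open>[0,T]\<close> of the function are relevant.\<close>

definition road_states :: "real \<Rightarrow> (real \<Rightarrow> real ^ 'n :: finite) set" where
  "road_states T = {u. continuous_on {0..T} u \<and>
     (\<forall>t\<in>{0..T}. (\<forall>j. 0 \<le> u t $ j \<and> u t $ j \<le> 1) \<and> (\<Sum>j\<in>UNIV. u t $ j) \<le> 1)}"

definition junction_states :: "real \<Rightarrow> (real \<Rightarrow> (real ^ 'n :: finite) ^ 3) set" where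
  "junction_states T = {U. \<forall>r. (\<lambda>t. U t $ r) \<in> road_states T}"

definition sup_norm :: "real \<Rightarrow> (real \<Rightarrow> (real ^ 'n :: finite) ^ 3) \<Rightarrow> real" where
  "sup_norm T U = (SUP t\<in>{0..T}. \<Sum>r\<in>UNIV. \<Sum>j\<in>UNIV. \<bar>U t $ r $ j\<bar>)"

text \<open>\<open>A j h k \<rho>\<close> stands for $A^j_{hk}[\rho]$.\<close>

definition table_of_games ::
    "('n :: finite \<Rightarrow> 'n \<Rightarrow> 'n \<Rightarrow> real \<Rightarrow> real) \<Rightarrow> bool" where
  "table_of_games A \<longleftrightarrow>
     (\<forall>h k j. \<forall>\<rho>\<in>{0..1}. 0 \<le> A j h k \<rho>) \<and>
     (\<forall>h k. \<forall>\<rho>\<in>{0..1}. (\<Sum>j\<in>UNIV. A j h k \<rho>) = 1) \<and>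
     (\<forall>h k j. \<exists>L. L-lipschitz_on {0..1} (A j h k))"

definition gain ::
    "real \<Rightarrow> ('n :: finite \<Rightarrow> 'n \<Rightarrow> 'n \<Rightarrow> real \<Rightarrow> real) \<Rightarrow> real ^ 'n \<Rightarrow> 'n \<Rightarrow> real" where
  "gain \<eta>0 A f j =
     \<eta>0 * density f * (\<Sum>h\<in>UNIV. \<Sum>k\<in>UNIV. A j h k (density f) * f $ h * f $ k)"

definition loss :: "real \<Rightarrow> real ^ 'n :: finite \<Rightarrow> real" where
  "loss \<eta>0 f = \<eta>0 * (density f)\<^sup>2"

definition flux_limiter :: "(real \<Rightarrow> real \<Rightarrow> real) \<Rightarrow> bool" where
  "flux_limiter \<Phi> \<longleftrightarrow>
     (\<forall>u\<in>{0..1}. \<forall>v\<in>{0..1}. 0 \<le> \<Phi> u v \<and> \<Phi> u v \<le> 1) \<and>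
     (\<forall>u\<in>{0..1}. \<forall>v\<in>{0..1}. u + v > 1 \<longrightarrow> \<Phi> u v * u \<le> 1 - v) \<and>
     (\<exists>L>0. \<forall>u1\<in>{0..1}. \<forall>v1\<in>{0..1}. \<forall>u2\<in>{0..1}. \<forall>v2\<in>{0..1}.
        \<bar>\<Phi> u2 v2 - \<Phi> u1 v1\<bar> \<le> L * (\<bar>u2 - u1\<bar> + \<bar>v2 - v1\<bar>))"

text \<open>
  The prescribed data: the initial densities on the three roads, the density entering road 1,
  and the flux limiters at the exits of roads 2 and 3. The flux limiter \<open>\<Phi>\<^sup>1\<close> at the entrance of
  road 1 is not free: it is determined by the incoming density together with the solution, and is
  therefore computed from these in \<open>bar_Phi\<close>.
\<close>

record ('n :: finite) junction_data =
  initial :: "(real ^ 'n) ^ 3"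
  inflow :: "real \<Rightarrow> real ^ 'n"
  exit_limiter2 :: "real \<Rightarrow> real"
  exit_limiter3 :: "real \<Rightarrow> real"

definition admissible_data :: "real \<Rightarrow> 'n :: finite junction_data \<Rightarrow> bool" where
  "admissible_data T d \<longleftrightarrow>
     (\<forall>r. (\<lambda>_. initial d $ r) \<in> road_states T) \<and>
     inflow d \<in> road_states T \<and>
     exit_limiter2 d \<in> borel_measurable (lebesgue_on {0..T}) \<and>
     (\<forall>t\<in>{0..T}. 0 \<le> exit_limiter2 d t \<and> exit_limiter2 d t \<le> 1) \<and>
     exit_limiter3 d \<in> borel_measurable (lebesgue_on {0..T}) \<and>
     (\<forall>t\<in>{0..T}. 0 \<le> exit_limiter3 d t \<and> exit_limiter3 d t \<le> 1)"

definition bar_Phi ::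
    "(real \<Rightarrow> real \<Rightarrow> real) \<Rightarrow> 'n :: finite junction_data \<Rightarrow> (real \<Rightarrow> (real ^ 'n) ^ 3) \<Rightarrow>
     3 \<Rightarrow> real \<Rightarrow> real" where
  "bar_Phi \<Phi> d F r t =
     (if r = 1 then \<Phi> (density (inflow d t)) (density (F t $ 1))
      else if r = 2 then exit_limiter2 d t
      else exit_limiter3 d t)"

text \<open>
  \<open>Phi01 \<Phi> \<alpha> f g\<close> is $\Phi^r_{0,1} = \Phi(\rho^r_0, \rho^r_1)$ for an exit road with flux share \<open>\<alpha>\<close>,
  where \<open>f\<close> and \<open>g\<close> are the distributions on road 1 and on the exit road.
\<close>

definition Phi01 ::
    "(real \<Rightarrow> real \<Rightarrow> real) \<Rightarrow> real \<Rightarrow> real ^ 'n :: {finite,linorder} \<Rightarrow> real ^ 'n :: {finite,linorder} \<Rightarrow> real" where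
  "Phi01 \<Phi> \<alpha> f g = \<Phi> (\<alpha> * (\<Sum>j\<in>UNIV - {first_class}. f $ j)) (density g)"

definition mild_solution ::
    "real \<Rightarrow> ('n :: {finite,linorder} \<Rightarrow> real) \<Rightarrow> real \<Rightarrow> real \<Rightarrow>
     ('n \<Rightarrow> 'n \<Rightarrow> 'n \<Rightarrow> real \<Rightarrow> real) \<Rightarrow> (real \<Rightarrow> real \<Rightarrow> real) \<Rightarrow>
     'n junction_data \<Rightarrow> (real \<Rightarrow> (real ^ 'n :: {finite,linorder}) ^ 3) \<Rightarrow> bool" where
  "mild_solution T v a \<eta>0 A \<Phi> d F \<longleftrightarrow>
     F \<in> junction_states T \<and>
     (\<forall>t\<in>{0..T}. \<forall>j.
        F t $ 1 $ j = initial d $ 1 $ j + (LINT s:{0..t}|lebesgue.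
            v j * (bar_Phi \<Phi> d F 1 s * inflow d s $ j
                   - (a * Phi01 \<Phi> a (F s $ 1) (F s $ 2)
                      + (1 - a) * Phi01 \<Phi> (1 - a) (F s $ 1) (F s $ 3)) * F s $ 1 $ j)
            + gain \<eta>0 A (F s $ 1) j - F s $ 1 $ j * loss \<eta>0 (F s $ 1)) \<and>
        F t $ 2 $ j = initial d $ 2 $ j + (LINT s:{0..t}|lebesgue.
            v j * (a * Phi01 \<Phi> a (F s $ 1) (F s $ 2) * F s $ 1 $ j * delta_c j
                   - bar_Phi \<Phi> d F 2 s * F s $ 2 $ j)
            + gain \<eta>0 A (F s $ 2) j - F s $ 2 $ j * loss \<eta>0 (F s $ 2)) \<and>
        F t $ 3 $ j = initial d $ 3 $ j + (LINT s:{0..t}|lebesgue.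
            v j * ((1 - a) * Phi01 \<Phi> (1 - a) (F s $ 1) (F s $ 3) * F s $ 1 $ j * delta_c j
                   - bar_Phi \<Phi> d F 3 s * F s $ 3 $ j)
            + gain \<eta>0 A (F s $ 3) j - F s $ 3 $ j * loss \<eta>0 (F s $ 3)))"

end

theory Submission
  imports Defs
begin

text \<open>
  The right-hand sides of the kinetic equations are built from coordinates of a bounded state space
  by sums, products and composition with \<open>\<Phi>\<close> and the table of games. Bounded Lipschitz functions
  are closed under these operations, so the right-hand sides are Lipschitz, uniformly in the data.
  Integrating their difference and applying Gronwall's inequality gives the stability estimate.
  It does not yield uniqueness directly, since the flux limiter at the entrance of road 1 depends on
  the solution; but for equal data the boundary term is itself at most a constant times the
  distance of the solutions, so Gronwall's inequality applies again, with zero initial term.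
\<close>

section \<open>Gronwall's inequality in integral form\<close>

text \<open>Write \<open>W t\<close> for the right-hand side
  \<open>D + K * integral {0..t} w\<close>. The function \<open>exp (- (K * t)) * W t\<close> has
  derivative \<open>exp (- (K * t)) * K * (w t - W t)\<close>, which is nonpositive by hypothesis.
  Hence it stays below its initial value \<open>D\<close>, and
  \<open>w t \<le> W t \<le> D * exp (K * t)\<close>.\<close>

lemma gronwall_integral:
  fixes w :: "real \<Rightarrow> real"
  assumes w: "continuous_on {0..T} w"
    and le: "\<And>t. t \<in> {0..T} \<Longrightarrow> w t \<le> D + K * integral {0..t} w"
    and K: "K \<ge> 0"
    and t: "t \<in> {0..T}"
  shows "w t \<le> D * exp (K * t)"
proof -
  define h where "h = (\<lambda>s. exp (- (K * s)) * (D + K * integral {0..s} w))"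
  have der: "(h has_real_derivative exp (- (K * s)) * (K * (w s - (D + K * integral {0..s} w))))
      (at s within {0..T})" if "s \<in> {0..T}" for s
  proof -
    have "((\<lambda>s. exp (- (K * s))) has_real_derivative - K * exp (- (K * s))) (at s within {0..T})"
      by (auto intro!: derivative_eq_intros)
    moreover have "((\<lambda>s. D + K * integral {0..s} w) has_real_derivative 0 + K * w s)
        (at s within {0..T})"
      by (rule DERIV_add[OF DERIV_const DERIV_cmult[OF integral_has_real_derivative[OF w that]]])
    ultimately have "(h has_real_derivative - K * exp (- (K * s)) * (D + K * integral {0..s} w)
        + (0 + K * w s) * exp (- (K * s))) (at s within {0..T})"
      unfolding h_def by (rule DERIV_mult)
    moreover have "- K * exp (- (K * s)) * (D + K * integral {0..s} w)
        + (0 + K * w s) * exp (- (K * s))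
        = exp (- (K * s)) * (K * (w s - (D + K * integral {0..s} w)))"
      by algebra
    ultimately show ?thesis
      by (simp only:)
  qed
  have "h t \<le> h 0"
  proof (rule DERIV_nonpos_imp_decreasing_open[of 0 t h])
    show "continuous_on {0..t} h"
      using t by (intro continuous_on_subset[OF DERIV_continuous_on[OF der]]) auto
  next
    \<comment> \<open>At interior points the derivative within \<open>{0..T}\<close> is the ordinary
      derivative, as the monotonicity criterion demands.\<close>
    fix x assume x: "0 < x" "x < t"
    then have "at x within {0..T} = at x"
      using t by (intro at_within_Icc_at) auto
    moreover have "K * (w x - (D + K * integral {0..x} w)) \<le> 0"
      using le[of x] x t by (intro mult_nonneg_nonpos[OF K]) auto
    then have "exp (- (K * x)) * (K * (w x - (D + K * integral {0..x} w))) \<le> 0"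
      by (intro mult_nonneg_nonpos[OF exp_ge_zero])
    moreover have "x \<in> {0..T}"
      using x t by simp
    ultimately show "\<exists>y. DERIV h x :> y \<and> y \<le> 0"
      using der[of x] by metis
  qed (use t in auto)
  then have "h t * exp (K * t) \<le> D * exp (K * t)"
    by (intro mult_right_mono) (simp_all add: h_def)
  moreover have "h t * exp (K * t) = D + K * integral {0..t} w"
    by (simp add: h_def exp_minus)
  ultimately have "D + K * integral {0..t} w \<le> D * exp (K * t)"
    by linarith
  then show ?thesis
    using le[OF t] by linarith
qed

section \<open>Bounded Lipschitz functions and their closure properties\<close>

text \<open>Boundedness is part of the notion because a product of Lipschitz functions is Lipschitz
  only under bounds on the factors. Constants are hidden by existential quantifiers, so the closure
  rules can be applied without tracking them.\<close>

definition bounded_lipschitz_on :: "'a :: metric_space set \<Rightarrow> ('a \<Rightarrow> real) \<Rightarrow> bool" where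
  "bounded_lipschitz_on X f \<longleftrightarrow> (\<exists>L. L-lipschitz_on X f) \<and> (\<exists>B. \<forall>x\<in>X. \<bar>f x\<bar> \<le> B)"

lemma bounded_lipschitz_on_const: "bounded_lipschitz_on X (\<lambda>x. c)"
  unfolding bounded_lipschitz_on_def by (blast intro: lipschitz_on_constant order_refl)

lemma bounded_lipschitz_on_add:
  assumes "bounded_lipschitz_on X f" "bounded_lipschitz_on X g"
  shows "bounded_lipschitz_on X (\<lambda>x. f x + g x)"
proof -
  obtain L M B C where "L-lipschitz_on X f" "M-lipschitz_on X g"
    and bd: "\<forall>x\<in>X. \<bar>f x\<bar> \<le> B" "\<forall>x\<in>X. \<bar>g x\<bar> \<le> C"
    using assms unfolding bounded_lipschitz_on_def by blast
  then have "(L + M)-lipschitz_on X (\<lambda>x. f x + g x)"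
    by (intro lipschitz_on_add)
  moreover have "\<forall>x\<in>X. \<bar>f x + g x\<bar> \<le> B + C"
    using bd by (meson abs_triangle_ineq add_mono order_trans)
  ultimately show ?thesis
    unfolding bounded_lipschitz_on_def by blast
qed

lemma bounded_lipschitz_on_mult:
  assumes "bounded_lipschitz_on X f" "bounded_lipschitz_on X g"
  shows "bounded_lipschitz_on X (\<lambda>x. f x * g x)"
proof -
  obtain L M B C where lip: "L-lipschitz_on X f" "M-lipschitz_on X g"
    and bd: "\<forall>x\<in>X. \<bar>f x\<bar> \<le> B" "\<forall>x\<in>X. \<bar>g x\<bar> \<le> C"
    using assms unfolding bounded_lipschitz_on_def by blast
  \<comment> \<open>Absolute values are taken because a Lipschitz constant must be nonnegative,
    while \<open>B\<close> and \<open>C\<close> may be negative if \<open>X\<close> is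
    empty.\<close>
  have "(\<bar>B\<bar> * M + L * \<bar>C\<bar>)-lipschitz_on X (\<lambda>x. f x * g x)"
  proof (rule lipschitz_onI)
    fix x y assume xy: "x \<in> X" "y \<in> X"
    have "f x * g x - f y * g y = f x * (g x - g y) + (f x - f y) * g y"
      by (simp add: algebra_simps)
    then have "\<bar>f x * g x - f y * g y\<bar> \<le> \<bar>f x\<bar> * \<bar>g x - g y\<bar> + \<bar>f x - f y\<bar> * \<bar>g y\<bar>"
      by (metis abs_mult abs_triangle_ineq)
    also have "\<dots> \<le> \<bar>B\<bar> * (M * dist x y) + (L * dist x y) * \<bar>C\<bar>"
    proof (intro add_mono mult_mono)
      show "\<bar>f x\<bar> \<le> \<bar>B\<bar>" "\<bar>g y\<bar> \<le> \<bar>C\<bar>"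
        using bd xy by force+
      show "\<bar>f x - f y\<bar> \<le> L * dist x y" "\<bar>g x - g y\<bar> \<le> M * dist x y"
        using lipschitz_onD[OF lip(1) xy] lipschitz_onD[OF lip(2) xy] by (auto simp: dist_real_def)
    qed (use lipschitz_on_nonneg[OF lip(1)] in auto)
    finally show "dist (f x * g x) (f y * g y) \<le> (\<bar>B\<bar> * M + L * \<bar>C\<bar>) * dist x y"
      by (simp add: dist_real_def algebra_simps)
  qed (use lip[THEN lipschitz_on_nonneg] in simp)
  moreover have "\<forall>x\<in>X. \<bar>f x * g x\<bar> \<le> \<bar>B\<bar> * \<bar>C\<bar>"
    unfolding abs_mult using bd by (intro ballI mult_mono) force+
  ultimately show ?thesis
    unfolding bounded_lipschitz_on_def by blast
qed

lemma bounded_lipschitz_on_diff: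
  assumes "bounded_lipschitz_on X f" "bounded_lipschitz_on X g"
  shows "bounded_lipschitz_on X (\<lambda>x. f x - g x)"
  using bounded_lipschitz_on_add[OF assms(1)
      bounded_lipschitz_on_mult[OF bounded_lipschitz_on_const[of X "-1"] assms(2)]]
  by simp

lemma bounded_lipschitz_on_sum:
  assumes "\<And>i. i \<in> I \<Longrightarrow> bounded_lipschitz_on X (f i)"
  shows "bounded_lipschitz_on X (\<lambda>x. \<Sum>i\<in>I. f i x)"
  using assms
  \<comment> \<open>A sum over an infinite index set is 0 by convention, so that case is the
    constant function.\<close>
  by (induction I rule: infinite_finite_induct)
     (auto intro: bounded_lipschitz_on_const bounded_lipschitz_on_add)

text \<open>The condition does not depend on the point: it stands for the case distinction on the
  road.\<close>

lemma bounded_lipschitz_on_if: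
  assumes "bounded_lipschitz_on X f" "bounded_lipschitz_on X g"
  shows "bounded_lipschitz_on X (\<lambda>x. if c then f x else g x)"
  using assms by (cases c) simp_all

text \<open>Meant for the entries of the table of games, evaluated at a density. The bound on
  \<open>h\<close> comes from compactness of the unit interval.\<close>

lemma bounded_lipschitz_on_compose_unit_interval:
  assumes u: "bounded_lipschitz_on X u" and range: "\<And>x. x \<in> X \<Longrightarrow> u x \<in> {0..1}"
    and h: "L-lipschitz_on {0..1::real} h"
  shows "bounded_lipschitz_on X (\<lambda>x. h (u x))"
proof -
  obtain M where "M-lipschitz_on X u"
    using u unfolding bounded_lipschitz_on_def by blast
  then have "(L * M)-lipschitz_on X (\<lambda>x. h (u x))"
    using range by (intro lipschitz_on_compose2 lipschitz_on_subset[OF h]) auto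
  moreover have "bounded (h ` {0..1})"
    by (intro compact_imp_bounded compact_continuous_image lipschitz_on_continuous_on[OF h]) simp
  then obtain B where "\<forall>s\<in>{0..1}. \<bar>h s\<bar> \<le> B"
    unfolding bounded_iff by auto
  ultimately show ?thesis
    unfolding bounded_lipschitz_on_def using range by blast
qed

text \<open>The Lipschitz constant of the limiter multiplies the sum of those of its arguments; the
  bound 1 is the range condition on \<open>\<Phi>\<close>.\<close>

lemma bounded_lipschitz_on_flux_limiter:
  assumes \<Phi>: "flux_limiter \<Phi>"
    and u: "bounded_lipschitz_on X u" "\<And>x. x \<in> X \<Longrightarrow> u x \<in> {0..1}"
    and w: "bounded_lipschitz_on X w" "\<And>x. x \<in> X \<Longrightarrow> w x \<in> {0..1}"
  shows "bounded_lipschitz_on X (\<lambda>x. \<Phi> (u x) (w x))"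
proof -
  obtain K where "K > 0" and K: "\<forall>u1\<in>{0..1}. \<forall>v1\<in>{0..1}. \<forall>u2\<in>{0..1}. \<forall>v2\<in>{0..1}.
        \<bar>\<Phi> u2 v2 - \<Phi> u1 v1\<bar> \<le> K * (\<bar>u2 - u1\<bar> + \<bar>v2 - v1\<bar>)"
    and bd: "\<forall>u\<in>{0..1}. \<forall>v\<in>{0..1}. 0 \<le> \<Phi> u v \<and> \<Phi> u v \<le> 1"
    using \<Phi> unfolding flux_limiter_def by blast
  obtain L M where L: "L-lipschitz_on X u" and M: "M-lipschitz_on X w"
    using u(1) w(1) unfolding bounded_lipschitz_on_def by blast
  have "(K * (L + M))-lipschitz_on X (\<lambda>x. \<Phi> (u x) (w x))"
  proof (rule lipschitz_onI)
    fix x y assume xy: "x \<in> X" "y \<in> X"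
    have "\<bar>\<Phi> (u x) (w x) - \<Phi> (u y) (w y)\<bar> \<le> K * (\<bar>u x - u y\<bar> + \<bar>w x - w y\<bar>)"
      using K xy u(2) w(2) by blast
    also have "\<dots> \<le> K * (L * dist x y + M * dist x y)"
      using \<open>K > 0\<close> lipschitz_onD[OF L xy] lipschitz_onD[OF M xy]
      by (intro mult_left_mono add_mono) (auto simp: dist_real_def)
    finally show "dist (\<Phi> (u x) (w x)) (\<Phi> (u y) (w y)) \<le> K * (L + M) * dist x y"
      by (simp add: dist_real_def algebra_simps)
  qed (use \<open>K > 0\<close> lipschitz_on_nonneg[OF L] lipschitz_on_nonneg[OF M] in simp)
  moreover have "\<forall>x\<in>X. \<bar>\<Phi> (u x) (w x)\<bar> \<le> 1"
    using bd u(2) w(2) by (metis abs_of_nonneg)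
  ultimately show ?thesis
    unfolding bounded_lipschitz_on_def by blast
qed

section \<open>State space and right-hand sides of the kinetic equations\<close>

definition simplex_states :: "(real ^ 'n :: finite) set" where
  "simplex_states = {u. (\<forall>j. 0 \<le> u $ j \<and> u $ j \<le> 1) \<and> (\<Sum>j\<in>UNIV. u $ j) \<le> 1}"

text \<open>
  Treating the values \<open>p\<close> of the boundary limiters and \<open>q\<close> of the inflow as coordinates next to the
  densities \<open>U\<close> makes the right-hand sides autonomous, with no dependence on the data.
\<close>

definition flow_states :: "(((real ^ 'n :: finite) ^ 3) \<times> (real ^ 3) \<times> (real ^ 'n)) set" where
  "flow_states = {U. \<forall>r. U $ r \<in> simplex_states} \<times> {p. \<forall>r. p $ r \<in> {0..1}} \<times> simplex_states"

definition flow_state ::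
    "(real \<Rightarrow> real \<Rightarrow> real) \<Rightarrow> 'n :: finite junction_data \<Rightarrow> (real \<Rightarrow> (real ^ 'n) ^ 3) \<Rightarrow>
     real \<Rightarrow> ((real ^ 'n) ^ 3) \<times> (real ^ 3) \<times> (real ^ 'n)" where
  "flow_state \<Phi> d F t = (F t, (\<chi> r. bar_Phi \<Phi> d F r t), inflow d t)"

text \<open>One formula covers all three roads, so that later estimates are uniform in
  \<open>r\<close> and \<open>j\<close>. The exit roads differ only in their flux share,
  \<open>a\<close> or \<open>1 - a\<close>.\<close>

definition flow_rate ::
    "('n :: {finite,linorder} \<Rightarrow> real) \<Rightarrow> real \<Rightarrow> real \<Rightarrow>
     ('n \<Rightarrow> 'n \<Rightarrow> 'n \<Rightarrow> real \<Rightarrow> real) \<Rightarrow> (real \<Rightarrow> real \<Rightarrow> real) \<Rightarrow>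
     3 \<Rightarrow> 'n \<Rightarrow> ((real ^ 'n :: {finite,linorder}) ^ 3) \<times> (real ^ 3) \<times> (real ^ 'n :: {finite,linorder}) \<Rightarrow> real" where
  "flow_rate v a \<eta>0 A \<Phi> r j = (\<lambda>(U, p, q).
     v j * (if r = 1 then p $ 1 * q $ j
              - (a * Phi01 \<Phi> a (U $ 1) (U $ 2)
                 + (1 - a) * Phi01 \<Phi> (1 - a) (U $ 1) (U $ 3)) * U $ 1 $ j
            else (if r = 2 then a else 1 - a) * Phi01 \<Phi> (if r = 2 then a else 1 - a) (U $ 1) (U $ r)
                   * U $ 1 $ j * delta_c j - p $ r * U $ r $ j)
     + gain \<eta>0 A (U $ r) j - U $ r $ j * loss \<eta>0 (U $ r))"

lemma mild_solution_flow_rate: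
  assumes "mild_solution T v a \<eta>0 A \<Phi> d F" "t \<in> {0..T}"
  shows "F t $ r $ j = initial d $ r $ j
    + (LINT s:{0..t}|lebesgue. flow_rate v a \<eta>0 A \<Phi> r j (flow_state \<Phi> d F s))"
proof -
  from exhaust_3[of r] consider "r = 1" | "r = 2" | "r = 3" by blast
  then show ?thesis
    using assms by cases (simp_all add: mild_solution_def flow_rate_def flow_state_def)
qed

text \<open>The index set \<open>J\<close> is arbitrary to cover both the density and the sum over
  all classes but the first that enters \<open>Phi01\<close>. Nonnegative entries make any partial
  sum at most the full one.\<close>

lemma simplex_states_bounds:
  assumes "u \<in> simplex_states"
  shows "0 \<le> u $ j" "u $ j \<le> 1" "(\<Sum>j\<in>J. u $ j) \<in> {0..1}"
proof -
  show "0 \<le> u $ j" "u $ j \<le> 1"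
    using assms by (auto simp: simplex_states_def)
  have "(\<Sum>j\<in>J. u $ j) \<le> (\<Sum>j\<in>UNIV. u $ j)"
    using assms by (intro sum_mono2) (auto simp: simplex_states_def)
  then show "(\<Sum>j\<in>J. u $ j) \<in> {0..1}"
    using assms by (auto simp: simplex_states_def intro: sum_nonneg)
qed

text \<open>Base case of the closure argument: projections do not increase the Euclidean distance,
  and on \<open>flow_states\<close> all coordinates lie in the unit interval.\<close>

lemma bounded_lipschitz_on_flow_states:
  fixes j :: "'n :: finite"
  defines "X \<equiv> flow_states :: (((real ^ 'n) ^ 3) \<times> (real ^ 3) \<times> (real ^ 'n)) set"
  shows "bounded_lipschitz_on X (\<lambda>z. fst z $ r $ j)"
    and "bounded_lipschitz_on X (\<lambda>z. fst (snd z) $ r)"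
    and "bounded_lipschitz_on X (\<lambda>z. snd (snd z) $ j)"
proof -
  have "1-lipschitz_on X (\<lambda>z. fst z $ r $ j)"
    by (rule lipschitz_onI, unfold mult_1)
       (rule order_trans[OF dist_vec_nth_le order_trans[OF dist_vec_nth_le dist_fst_le]], rule zero_le_one)
  moreover have "1-lipschitz_on X (\<lambda>z. fst (snd z) $ r)"
    by (rule lipschitz_onI, unfold mult_1)
       (rule order_trans[OF dist_vec_nth_le order_trans[OF dist_fst_le dist_snd_le]], rule zero_le_one)
  moreover have "1-lipschitz_on X (\<lambda>z. snd (snd z) $ j)"
    by (rule lipschitz_onI, unfold mult_1)
       (rule order_trans[OF dist_vec_nth_le order_trans[OF dist_snd_le dist_snd_le]], rule zero_le_one)
  moreover have "\<bar>fst z $ r $ j\<bar> \<le> 1" "\<bar>fst (snd z) $ r\<bar> \<le> 1" "\<bar>snd (snd z) $ j\<bar> \<le> 1"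
    if "z \<in> X" for z
    using that by (auto simp: X_def flow_states_def simplex_states_bounds)
  ultimately show "bounded_lipschitz_on X (\<lambda>z. fst z $ r $ j)"
    "bounded_lipschitz_on X (\<lambda>z. fst (snd z) $ r)"
    "bounded_lipschitz_on X (\<lambda>z. snd (snd z) $ j)"
    unfolding bounded_lipschitz_on_def by blast+
qed

text \<open>Besides sums and products of coordinates, \<open>flow_rate\<close> contains only two
  kinds of terms, the limiters \<open>Phi01\<close> and the table of games at a density; each has
  its own composition rule.\<close>

lemma bounded_lipschitz_on_flow_rate:
  fixes A :: "'n :: {finite,linorder} \<Rightarrow> 'n \<Rightarrow> 'n \<Rightarrow> real \<Rightarrow> real"
  assumes "a \<in> {0..1}" "table_of_games A" "flux_limiter \<Phi>"
  shows "bounded_lipschitz_on flow_states (flow_rate v a \<eta>0 A \<Phi> r j)"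
proof -
  let ?X = "flow_states :: (((real ^ 'n :: {finite,linorder}) ^ 3) \<times> (real ^ 3) \<times> (real ^ 'n :: {finite,linorder})) set"
  note intros = bounded_lipschitz_on_const bounded_lipschitz_on_add bounded_lipschitz_on_diff
    bounded_lipschitz_on_mult bounded_lipschitz_on_sum bounded_lipschitz_on_flow_states
  \<comment> \<open>Both \<open>\<Phi>\<close> and the table of games are controlled on the unit
    interval only.\<close>
  have density: "density (fst z $ r) \<in> {0..1}"
    if "z \<in> ?X" for z and r
    using that by (auto simp: flow_states_def density_def
        simplex_states_bounds(3)[simplified])
  have lip_density: "bounded_lipschitz_on ?X (\<lambda>z. density (fst z $ r))" for r
    unfolding density_def by (intro intros)
  have Phi: "bounded_lipschitz_on ?X (\<lambda>z. Phi01 \<Phi> \<alpha> (fst z $ 1) (fst z $ r))"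
    if "\<alpha> \<in> {0..1}" for \<alpha> r
    unfolding Phi01_def
  proof (rule bounded_lipschitz_on_flux_limiter[OF assms(3) _ _ lip_density density])
    show "bounded_lipschitz_on ?X (\<lambda>z. \<alpha> * (\<Sum>j\<in>UNIV - {first_class}. fst z $ 1 $ j))"
      by (intro intros)
    show "\<alpha> * (\<Sum>j\<in>UNIV - {first_class}. fst z $ 1 $ j) \<in> {0..1}" if "z \<in> ?X" for z
      using that \<open>\<alpha> \<in> {0..1}\<close>
        simplex_states_bounds(3)[of "fst z $ 1" "UNIV - {first_class}"]
      by (auto simp: flow_states_def intro: mult_le_one)
  qed
  have A: "bounded_lipschitz_on ?X (\<lambda>z. A j h k (density (fst z $ r)))" for h k
  proof -
    obtain L where L: "L-lipschitz_on {0..1} (A j h k)"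
      using \<open>table_of_games A\<close> unfolding table_of_games_def by blast
    show ?thesis
      by (rule bounded_lipschitz_on_compose_unit_interval[OF lip_density density L])
  qed
  have "bounded_lipschitz_on ?X (\<lambda>z. gain \<eta>0 A (fst z $ r) j)"
    unfolding gain_def by (intro intros lip_density A)
  moreover have "bounded_lipschitz_on ?X (\<lambda>z. loss \<eta>0 (fst z $ r))"
    unfolding loss_def power2_eq_square by (intro intros lip_density)
  moreover have "bounded_lipschitz_on ?X (\<lambda>z. if r = 1 then fst (snd z) $ 1 * snd (snd z) $ j
              - (a * Phi01 \<Phi> a (fst z $ 1) (fst z $ 2)
                 + (1 - a) * Phi01 \<Phi> (1 - a) (fst z $ 1) (fst z $ 3)) * fst z $ 1 $ j
            else (if r = 2 then a else 1 - a)
                * Phi01 \<Phi> (if r = 2 then a else 1 - a) (fst z $ 1) (fst z $ r)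
                * fst z $ 1 $ j * delta_c j - fst (snd z) $ r * fst z $ r $ j)"
    using \<open>a \<in> {0..1}\<close>
    by (intro intros Phi bounded_lipschitz_on_if) simp_all
  ultimately show ?thesis
    unfolding flow_rate_def case_prod_beta by (intro intros)
qed

section \<open>Measurability and integrability along solutions\<close>

lemma bounded_measurable_set_integrable:
  fixes f :: "real \<Rightarrow> real"
  assumes "f \<in> borel_measurable (lebesgue_on {a..b})" "\<And>x. x \<in> {a..b} \<Longrightarrow> \<bar>f x\<bar> \<le> B"
  shows "set_integrable lebesgue {a..b} f"
proof -
  interpret finite_measure "lebesgue_on {a..b}"
    by (rule finite_measure_lebesgue_on) simp
  have "integrable (lebesgue_on {a..b}) f"
    using assms by (intro integrable_const_bound[where B = B]) auto
  then show ?thesis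
    by (simp add: set_integrable_def integrable_restrict_space)
qed

text \<open>Makes the Lipschitz bounds on \<open>flow_states\<close> applicable along solutions. For
  the entrance limiter, the range condition on \<open>\<Phi>\<close> is applied to two
  densities.\<close>

lemma flow_state_in_flow_states:
  assumes d: "admissible_data T d" and F: "F \<in> junction_states T" and \<Phi>: "flux_limiter \<Phi>"
    and t: "t \<in> {0..T}"
  shows "flow_state \<Phi> d F t \<in> flow_states"
proof -
  have S: "F t $ r \<in> simplex_states" "inflow d t \<in> simplex_states" for r
    using d F t by (auto simp: admissible_data_def junction_states_def road_states_def
        simplex_states_def)
  then have "density (F t $ 1) \<in> {0..1}" "density (inflow d t) \<in> {0..1}"
    unfolding density_def by (blast intro: simplex_states_bounds)+
  then have "bar_Phi \<Phi> d F r t \<in> {0..1}" for r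
    using d t \<Phi> by (auto simp: bar_Phi_def admissible_data_def flux_limiter_def)
  then show ?thesis
    using S by (auto simp: flow_state_def flow_states_def)
qed

lemma flux_limiter_continuous_on:
  assumes \<Phi>: "flux_limiter \<Phi>"
  shows "continuous_on ({0..1} \<times> {0..1}) (\<lambda>p. \<Phi> (fst p) (snd p))"
proof -
  have "1-lipschitz_on ({0..1} \<times> {0..1}) (fst :: real \<times> real \<Rightarrow> real)"
    "1-lipschitz_on ({0..1} \<times> {0..1}) (snd :: real \<times> real \<Rightarrow> real)"
    by (rule lipschitz_onI; simp add: dist_fst_le dist_snd_le del: split_paired_All)+
  then have "bounded_lipschitz_on ({0..1} \<times> {0..1}) (\<lambda>p. \<Phi> (fst p) (snd p))"
    by (intro bounded_lipschitz_on_flux_limiter[OF \<Phi>])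
       (auto simp: bounded_lipschitz_on_def intro!: exI[of _ 1])
  then show ?thesis
    unfolding bounded_lipschitz_on_def by (blast intro: lipschitz_on_continuous_on)
qed

lemma junction_states_continuous_on:
  "U \<in> junction_states T \<Longrightarrow> continuous_on {0..T} U"
  using continuous_on_vec_lambda[of "{0..T}" "\<lambda>r t. U t $ r"]
  by (auto simp: junction_states_def road_states_def)

text \<open>On road 1 the limiter is a continuous function of two continuous densities; on the exit
  roads measurability is part of admissibility.\<close>

lemma bar_Phi_measurable:
  assumes d: "admissible_data T d" and F: "F \<in> junction_states T" and \<Phi>: "flux_limiter \<Phi>"
  shows "bar_Phi \<Phi> d F r \<in> borel_measurable (lebesgue_on {0..T})"
proof (cases "r = 1")
  case True
  have "continuous_on {0..T} F" "continuous_on {0..T} (inflow d)"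
    using d F by (auto simp: admissible_data_def road_states_def junction_states_continuous_on)
  then have "continuous_on {0..T} (\<lambda>t. (density (inflow d t), density (F t $ 1)))"
    unfolding density_def by (intro continuous_intros)
  moreover have "density (inflow d t) \<in> {0..1}" "density (F t $ 1) \<in> {0..1}" if "t \<in> {0..T}" for t
    using flow_state_in_flow_states[OF d F \<Phi> that]
    unfolding density_def flow_state_def flow_states_def
    by (blast intro: simplex_states_bounds)+
  ultimately have "continuous_on {0..T}
      (\<lambda>t. (\<lambda>p. \<Phi> (fst p) (snd p)) (density (inflow d t), density (F t $ 1)))"
    by (intro continuous_on_compose2[OF flux_limiter_continuous_on[OF \<Phi>]]) auto
  then show ?thesis
    using True by (intro continuous_imp_measurable_on_sets_lebesgue)
      (auto simp: bar_Phi_def[abs_def])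
next
  case False
  then show ?thesis
    using d by (cases "r = 2") (auto simp: bar_Phi_def[abs_def] admissible_data_def)
qed

text \<open>The integral equations in \<open>mild_solution\<close> do not assert integrability, and
  the integral of a non-integrable function is 0 by convention. Integrability is therefore derived
  from measurability and a uniform bound.\<close>

lemma flow_rate_integrable:
  fixes d :: "'n :: {finite,linorder} junction_data"
  assumes d: "admissible_data T d" and F: "F \<in> junction_states T"
    and a: "a \<in> {0..1}" and A: "table_of_games A" and \<Phi>: "flux_limiter \<Phi>"
  shows "set_integrable lebesgue {0..T} (\<lambda>s. flow_rate v a \<eta>0 A \<Phi> r j (flow_state \<Phi> d F s))"
proof -
  let ?M = "lebesgue_on {0..T}"
  note lip = bounded_lipschitz_on_flow_rate[OF a A \<Phi>, of v \<eta>0 r j]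
  then obtain B where B: "\<forall>z\<in>flow_states. \<bar>flow_rate v a \<eta>0 A \<Phi> r j z\<bar> \<le> B"
    unfolding bounded_lipschitz_on_def by blast
  have "F \<in> borel_measurable ?M"
    using F by (intro continuous_imp_measurable_on_sets_lebesgue junction_states_continuous_on) auto
  moreover have "inflow d \<in> borel_measurable ?M"
    using d by (intro continuous_imp_measurable_on_sets_lebesgue)
      (auto simp: admissible_data_def road_states_def)
  moreover have "(\<lambda>t. \<chi> r. bar_Phi \<Phi> d F r t) \<in> borel_measurable ?M"
    by (subst borel_measurable_euclidean_space)
       (auto simp: Basis_vec_def inner_axis bar_Phi_measurable[OF d F \<Phi>])
  ultimately have "flow_state \<Phi> d F \<in> borel_measurable ?M"
    unfolding flow_state_def[abs_def] by (intro borel_measurable_Pair)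
  \<comment> \<open>The rate is known to be continuous only on \<open>flow_states\<close>, so the
    composition passes through the restricted Borel space.\<close>
  then have "flow_state \<Phi> d F \<in> measurable ?M (restrict_space borel flow_states)"
    using flow_state_in_flow_states[OF d F \<Phi>] by (intro measurable_restrict_space2) auto
  moreover have "flow_rate v a \<eta>0 A \<Phi> r j \<in> borel_measurable (restrict_space borel flow_states)"
    using lip unfolding bounded_lipschitz_on_def
    by (blast intro: borel_measurable_continuous_on_restrict lipschitz_on_continuous_on)
  ultimately have "(\<lambda>s. flow_rate v a \<eta>0 A \<Phi> r j (flow_state \<Phi> d F s)) \<in> borel_measurable ?M"
    by (rule measurable_compose)
  then show ?thesis
    using B flow_state_in_flow_states[OF d F \<Phi>]
    by (intro bounded_measurable_set_integrable) blast+
qed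

section \<open>Distances between solutions and between boundary data\<close>

text \<open>The quantity at a fixed time whose supremum over \<open>{0..T}\<close> is the
  \<open>sup_norm\<close> of the difference.\<close>

definition l1_dist :: "(real ^ 'n :: finite) ^ 3 \<Rightarrow> (real ^ 'n) ^ 3 \<Rightarrow> real" where
  "l1_dist U V = (\<Sum>r\<in>UNIV. norm1 (U $ r - V $ r))"

text \<open>The integrand of the stability estimate. The solutions appear as arguments because of
  the entrance limiter of road 1.\<close>

definition boundary_dist ::
    "(real \<Rightarrow> real \<Rightarrow> real) \<Rightarrow> 'n :: finite junction_data \<Rightarrow> 'n junction_data \<Rightarrow>
     (real \<Rightarrow> (real ^ 'n) ^ 3) \<Rightarrow> (real \<Rightarrow> (real ^ 'n) ^ 3) \<Rightarrow> real \<Rightarrow> real" where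
  "boundary_dist \<Phi> d e F G t =
     (\<Sum>r\<in>UNIV. \<bar>bar_Phi \<Phi> e G r t - bar_Phi \<Phi> d F r t\<bar>) + norm1 (inflow e t - inflow d t)"

lemma l1_dist_nonneg: "l1_dist U V \<ge> 0"
  by (simp add: l1_dist_def norm1_def sum_nonneg)

lemma boundary_dist_nonneg: "boundary_dist \<Phi> d e F G t \<ge> 0"
  by (simp add: boundary_dist_def norm1_def sum_nonneg)

lemma l1_dist_eq_0_iff: "l1_dist U V = 0 \<longleftrightarrow> U = V"
  by (auto simp: l1_dist_def norm1_def sum_nonneg_eq_0_iff sum_nonneg vec_eq_iff)

lemma l1_dist_continuous_on:
  assumes "U \<in> junction_states T" "V \<in> junction_states T"
  shows "continuous_on {0..T} (\<lambda>t. l1_dist (U t) (V t))"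
  unfolding l1_dist_def norm1_def
  by (intro continuous_intros junction_states_continuous_on assms)

lemma norm_le_norm1: "norm x \<le> norm1 x"
  unfolding norm1_def by (rule norm_le_l1_cart)

text \<open>The Euclidean distance of a pair, and of a vector, is at most the sum of the distances
  of its components; this is applied at every level of nesting.\<close>

lemma dist_flow_state_le:
  "dist (flow_state \<Phi> e G t) (flow_state \<Phi> d F t)
     \<le> l1_dist (G t) (F t) + boundary_dist \<Phi> d e F G t"
proof -
  have U: "dist (G t) (F t) \<le> l1_dist (G t) (F t)"
    unfolding l1_dist_def dist_vec_def[of "G t"]
    by (rule order_trans[OF L2_set_le_sum]) (auto intro: sum_mono simp: dist_norm norm_le_norm1)
  have p: "dist (\<chi> r. bar_Phi \<Phi> e G r t) (\<chi> r. bar_Phi \<Phi> d F r t)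
      \<le> (\<Sum>r\<in>UNIV. \<bar>bar_Phi \<Phi> e G r t - bar_Phi \<Phi> d F r t\<bar>)"
    using norm_le_l1_cart[of "(\<chi> r. bar_Phi \<Phi> e G r t) - (\<chi> r. bar_Phi \<Phi> d F r t)"]
    by (simp add: dist_norm)
  have q: "dist (inflow e t) (inflow d t) \<le> norm1 (inflow e t - inflow d t)"
    by (simp add: dist_norm norm_le_norm1)
  have pair: "dist (x, y) (x', y') \<le> dist x x' + dist y y'"
    for x x' :: "'x :: metric_space" and y y' :: "'y :: metric_space"
    unfolding dist_Pair_Pair by (rule sqrt_sum_squares_le_sum) auto
  show ?thesis
    unfolding flow_state_def boundary_dist_def
    using pair[of "G t" "(\<chi> r. bar_Phi \<Phi> e G r t, inflow e t)" "F t" "(\<chi> r. bar_Phi \<Phi> d F r t, inflow d t)"]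
      pair[of "\<chi> r. bar_Phi \<Phi> e G r t" "inflow e t" "\<chi> r. bar_Phi \<Phi> d F r t" "inflow d t"]
      U p q
    by linarith
qed

lemma boundary_dist_integrable:
  fixes d e :: "'n :: finite junction_data"
  assumes d: "admissible_data T d" "F \<in> junction_states T"
    and e: "admissible_data T e" "G \<in> junction_states T"
    and \<Phi>: "flux_limiter \<Phi>"
  shows "set_integrable lebesgue {0..T} (boundary_dist \<Phi> d e F G)"
proof (rule bounded_measurable_set_integrable)
  have "continuous_on {0..T} (\<lambda>t. norm1 (inflow e t - inflow d t))"
    unfolding norm1_def
    using d(1) e(1) by (intro continuous_intros) (auto simp: admissible_data_def road_states_def)
  then have "(\<lambda>t. norm1 (inflow e t - inflow d t)) \<in> borel_measurable (lebesgue_on {0..T})"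
    by (intro continuous_imp_measurable_on_sets_lebesgue) auto
  moreover note bar_Phi_measurable[OF d \<Phi>, measurable] bar_Phi_measurable[OF e \<Phi>, measurable]
  ultimately show "boundary_dist \<Phi> d e F G \<in> borel_measurable (lebesgue_on {0..T})"
    unfolding boundary_dist_def[abs_def] by measurable
next
  fix t assume t: "t \<in> {0..T}"
  note st = flow_state_in_flow_states[OF d \<Phi> t] flow_state_in_flow_states[OF e \<Phi> t]
  have "\<bar>bar_Phi \<Phi> e G r t - bar_Phi \<Phi> d F r t\<bar> \<le> 1" for r
  proof -
    have "bar_Phi \<Phi> d F r t \<in> {0..1}" "bar_Phi \<Phi> e G r t \<in> {0..1}"
      using st by (simp_all add: flow_state_def flow_states_def)
    then show ?thesis by auto
  qed
  then have "(\<Sum>r\<in>UNIV. \<bar>bar_Phi \<Phi> e G r t - bar_Phi \<Phi> d F r t\<bar>) \<le> (\<Sum>r\<in>(UNIV :: 3 set). 1)"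
    by (intro sum_mono)
  moreover have "\<bar>inflow e t $ j - inflow d t $ j\<bar> \<le> 1" for j
  proof -
    have "inflow d t \<in> simplex_states" "inflow e t \<in> simplex_states"
      using st by (simp_all add: flow_state_def flow_states_def)
    then show ?thesis
      using simplex_states_bounds(1,2)[of "inflow d t" j]
        simplex_states_bounds(1,2)[of "inflow e t" j] by auto
  qed
  then have "norm1 (inflow e t - inflow d t) \<le> (\<Sum>j\<in>(UNIV :: 'n set). 1)"
    unfolding norm1_def vector_minus_component by (intro sum_mono)
  \<comment> \<open>Three limiter differences and \<open>CARD('n)\<close> inflow differences, each
    at most 1.\<close>
  ultimately show "\<bar>boundary_dist \<Phi> d e F G t\<bar> \<le> 3 + real CARD('n)"
    by (auto simp: boundary_dist_def norm1_def sum_nonneg)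
qed

text \<open>There are finitely many components, and the sum of their nonnegative constants dominates
  each of them.\<close>

lemma flow_rate_uniform_lipschitz:
  fixes A :: "'n :: {finite,linorder} \<Rightarrow> 'n \<Rightarrow> 'n \<Rightarrow> real \<Rightarrow> real"
  assumes "a \<in> {0..1}" "table_of_games A" "flux_limiter \<Phi>"
  obtains K where "K \<ge> 0" "\<And>r j. K-lipschitz_on flow_states (flow_rate v a \<eta>0 A \<Phi> r j)"
proof -
  obtain L where L: "(L r j)-lipschitz_on flow_states (flow_rate v a \<eta>0 A \<Phi> r j)" for r j
    using bounded_lipschitz_on_flow_rate[OF assms, of v \<eta>0]
    unfolding bounded_lipschitz_on_def by metis
  have nonneg: "L r j \<ge> 0" for r j
    using L by (rule lipschitz_on_nonneg)
  have "L r j \<le> (\<Sum>r\<in>UNIV. \<Sum>j\<in>UNIV. L r j)" for r j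
    using member_le_sum[of j UNIV "L r"] member_le_sum[of r UNIV "\<lambda>r. \<Sum>j\<in>UNIV. L r j"]
    by (simp add: nonneg sum_nonneg)
  then show ?thesis
    using nonneg lipschitz_on_le[OF L]
    by (intro that[of "\<Sum>r\<in>UNIV. \<Sum>j\<in>UNIV. L r j"] sum_nonneg) blast+
qed

section \<open>Integral inequality for the difference of two solutions\<close>

text \<open>Subtract the integral equations, apply the Lipschitz bound under the integral and sum
  over all components. \<open>M\<close> is fixed before the data and the solutions, which makes the
  final constant uniform; \<open>M \<ge> 1\<close> later serves to collect the terms under one
  factor.\<close>

lemma mild_solutions_integral_inequality:
  fixes v :: "'n :: {finite,linorder} \<Rightarrow> real"
  assumes a: "a \<in> {0..1}" and A: "table_of_games A" and \<Phi>: "flux_limiter \<Phi>"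
  obtains M where "M \<ge> 1"
    "\<And>d e F G t. \<lbrakk>admissible_data T d; admissible_data T e; mild_solution T v a \<eta>0 A \<Phi> d F;
        mild_solution T v a \<eta>0 A \<Phi> e G; t \<in> {0..T}\<rbrakk> \<Longrightarrow>
      l1_dist (G t) (F t) \<le> l1_dist (initial e) (initial d)
        + M * integral {0..t} (\<lambda>s. l1_dist (G s) (F s))
        + M * integral {0..t} (boundary_dist \<Phi> d e F G)"
proof -
  obtain K where "K \<ge> 0"
    and K: "\<And>r j. K-lipschitz_on flow_states (flow_rate v a \<eta>0 A \<Phi> r j)"
    using flow_rate_uniform_lipschitz[OF a A \<Phi>] by blast
  \<comment> \<open>The number of components, each of which contributes one term with factor
    \<open>K\<close>.\<close>
  define N where "N = 3 * real CARD('n)"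
  show thesis
  proof (rule that[of "max 1 (N * K)"])
    fix d e F G t
    assume d: "admissible_data T d" and e: "admissible_data T e"
      and mF: "mild_solution T v a \<eta>0 A \<Phi> d F" and mG: "mild_solution T v a \<eta>0 A \<Phi> e G"
      and t: "t \<in> {0..T}"
    define w where "w = (\<lambda>s. l1_dist (G s) (F s))"
    define b where "b = boundary_dist \<Phi> d e F G"
    have F: "F \<in> junction_states T" and G: "G \<in> junction_states T"
      using mF mG by (auto simp: mild_solution_def)
    have sub: "{0..t} \<subseteq> {0..T}"
      using t by auto
    have w: "w integrable_on {0..t}"
      unfolding w_def
      by (intro integrable_continuous_real continuous_on_subset[OF l1_dist_continuous_on[OF G F] sub])
    have b: "b integrable_on {0..t}"
      using set_lebesgue_integral_eq_integral(1)[OF boundary_dist_integrable[OF d F e G \<Phi>]] sub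
      unfolding b_def by (rule integrable_on_subinterval)
    have component: "\<bar>G t $ r $ j - F t $ r $ j\<bar> \<le> \<bar>initial e $ r $ j - initial d $ r $ j\<bar>
        + K * (integral {0..t} w + integral {0..t} b)" for r j
    proof -
      let ?q = "\<lambda>d F s. flow_rate v a \<eta>0 A \<Phi> r j (flow_state \<Phi> d F s)"
      \<comment> \<open>Stated for generic data so as to serve both solutions. It also passes from
        the Lebesgue integral to the gauge integral used in Gronwall's inequality.\<close>
      have rep: "?q d F integrable_on {0..t}"
          "F t $ r $ j = initial d $ r $ j + integral {0..t} (?q d F)"
        if "admissible_data T d" "mild_solution T v a \<eta>0 A \<Phi> d F" for d F
      proof -
        have "F \<in> junction_states T"
          using that(2) by (simp add: mild_solution_def)
        then have "set_integrable lebesgue {0..t} (?q d F)"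
          using flow_rate_integrable[OF that(1) _ a A \<Phi>] sub
          by (blast intro: set_integrable_subset lmeasurable_interval fmeasurableD)
        from set_lebesgue_integral_eq_integral[OF this]
        show "?q d F integrable_on {0..t}"
            "F t $ r $ j = initial d $ r $ j + integral {0..t} (?q d F)"
          using mild_solution_flow_rate[OF that(2) t, of r j] by auto
      qed
      have "norm (integral {0..t} (\<lambda>s. ?q e G s - ?q d F s)) \<le> integral {0..t} (\<lambda>s. K * (w s + b s))"
      proof (rule integral_norm_bound_integral)
        show "(\<lambda>s. ?q e G s - ?q d F s) integrable_on {0..t}"
          by (intro integrable_diff rep d e mF mG)
        show "(\<lambda>s. K * (w s + b s)) integrable_on {0..t}"
          using integrable_on_cmult_left[OF integrable_add[OF w b], of K] by simp
        fix s assume "s \<in> {0..t}"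
        then have s: "s \<in> {0..T}" using sub by blast
        have "\<bar>?q e G s - ?q d F s\<bar> \<le> K * dist (flow_state \<Phi> e G s) (flow_state \<Phi> d F s)"
          using lipschitz_onD[OF K flow_state_in_flow_states[OF e G \<Phi> s]
              flow_state_in_flow_states[OF d F \<Phi> s]]
          by (simp add: dist_real_def)
        also have "\<dots> \<le> K * (w s + b s)"
          using \<open>K \<ge> 0\<close> dist_flow_state_le unfolding w_def b_def by (intro mult_left_mono)
        finally show "norm (?q e G s - ?q d F s) \<le> K * (w s + b s)"
          by simp
      qed
      moreover have "integral {0..t} (\<lambda>s. ?q e G s - ?q d F s)
          = integral {0..t} (?q e G) - integral {0..t} (?q d F)"
        by (intro integral_diff rep d e mF mG)
      moreover have "integral {0..t} (\<lambda>s. K * (w s + b s))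
          = K * (integral {0..t} w + integral {0..t} b)"
        by (simp add: integral_add[OF w b])
      ultimately show ?thesis
        using rep(2)[OF d mF] rep(2)[OF e mG] unfolding real_norm_def by linarith
    qed
    have "w t = (\<Sum>r\<in>UNIV. \<Sum>j\<in>UNIV. \<bar>G t $ r $ j - F t $ r $ j\<bar>)"
      by (simp add: w_def l1_dist_def norm1_def)
    also have "\<dots> \<le> (\<Sum>r\<in>UNIV. \<Sum>j\<in>UNIV. \<bar>initial e $ r $ j - initial d $ r $ j\<bar>
        + K * (integral {0..t} w + integral {0..t} b))"
      by (intro sum_mono component)
    also have "\<dots> = l1_dist (initial e) (initial d)
        + N * K * (integral {0..t} w + integral {0..t} b)"
      by (simp add: sum.distrib l1_dist_def norm1_def N_def)
    also have "\<dots> \<le> l1_dist (initial e) (initial d)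
        + max 1 (N * K) * (integral {0..t} w + integral {0..t} b)"
      using w b by (intro add_left_mono mult_right_mono add_nonneg_nonneg integral_nonneg)
        (auto simp: w_def b_def l1_dist_nonneg boundary_dist_nonneg)
    finally show "l1_dist (G t) (F t) \<le> l1_dist (initial e) (initial d)
        + max 1 (N * K) * integral {0..t} (\<lambda>s. l1_dist (G s) (F s))
        + max 1 (N * K) * integral {0..t} (boundary_dist \<Phi> d e F G)"
      unfolding w_def b_def by (simp add: algebra_simps)
  qed simp
qed

section \<open>The boundary term for equal data\<close>

text \<open>Inflow and exit limiters cancel. What remains is the change of \<open>\<Phi>\<close> in
  its second argument, the density on road 1, which the Lipschitz condition controls.\<close>

lemma boundary_dist_same_data:
  assumes d: "admissible_data T d" and F: "F \<in> junction_states T" and G: "G \<in> junction_states T"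
    and \<Phi>: "flux_limiter \<Phi>"
  obtains L where "L > 0"
    "\<And>s. s \<in> {0..T} \<Longrightarrow> boundary_dist \<Phi> d d F G s \<le> L * l1_dist (G s) (F s)"
proof -
  obtain L where "L > 0" and L: "\<forall>u1\<in>{0..1}. \<forall>v1\<in>{0..1}. \<forall>u2\<in>{0..1}. \<forall>v2\<in>{0..1}.
        \<bar>\<Phi> u2 v2 - \<Phi> u1 v1\<bar> \<le> L * (\<bar>u2 - u1\<bar> + \<bar>v2 - v1\<bar>)"
    using \<Phi> unfolding flux_limiter_def by blast
  have "boundary_dist \<Phi> d d F G s \<le> L * l1_dist (G s) (F s)" if s: "s \<in> {0..T}" for s
  proof -
    have unit: "density (inflow d s) \<in> {0..1}" "density (F s $ 1) \<in> {0..1}"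
        "density (G s $ 1) \<in> {0..1}"
      using flow_state_in_flow_states[OF d F \<Phi> s] flow_state_in_flow_states[OF d G \<Phi> s]
      unfolding density_def flow_state_def flow_states_def
      by (blast intro: simplex_states_bounds)+
    have "boundary_dist \<Phi> d d F G s
        = \<bar>\<Phi> (density (inflow d s)) (density (G s $ 1)) - \<Phi> (density (inflow d s)) (density (F s $ 1))\<bar>"
      by (simp add: boundary_dist_def bar_Phi_def sum_3 norm1_def)
    also have "\<dots> \<le> L * \<bar>density (G s $ 1) - density (F s $ 1)\<bar>"
      using L unit by fastforce
    also have "\<bar>density (G s $ 1) - density (F s $ 1)\<bar> \<le> norm1 (G s $ 1 - F s $ 1)"
      unfolding density_def norm1_def sum_subtractf[symmetric] vector_minus_component
      by (rule sum_abs)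
    also have "\<dots> \<le> l1_dist (G s) (F s)"
      unfolding l1_dist_def
      by (rule member_le_sum[of 1]) (auto simp: norm1_def sum_nonneg)
    finally show ?thesis
      using \<open>L > 0\<close> by simp
  qed
  then show ?thesis
    using \<open>L > 0\<close> that by blast
qed

section \<open>Stability estimate and uniqueness\<close>

theorem theorem4p2:
  fixes T a \<eta>0 :: real
    and v :: "'n :: {finite,linorder} \<Rightarrow> real"
    and A :: "'n \<Rightarrow> 'n \<Rightarrow> 'n \<Rightarrow> real \<Rightarrow> real"
    and \<Phi> :: "real \<Rightarrow> real \<Rightarrow> real"
  assumes "T > 0"
    and "CARD('n) \<ge> 2"
    and "speeds v"
    and "a \<in> {0..1}"
    and "\<eta>0 > 0"
    and "table_of_games A"
    and "flux_limiter \<Phi>"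
  shows "(\<exists>C>0. \<forall>(d\<^sub>f :: 'n junction_data) (d\<^sub>g :: 'n junction_data) F G.
            admissible_data T d\<^sub>f \<longrightarrow> admissible_data T d\<^sub>g \<longrightarrow>
            mild_solution T v a \<eta>0 A \<Phi> d\<^sub>f F \<longrightarrow> mild_solution T v a \<eta>0 A \<Phi> d\<^sub>g G \<longrightarrow>
            sup_norm T (\<lambda>t. G t - F t) \<le>
              C * ((\<Sum>r\<in>UNIV. norm1 (initial d\<^sub>g $ r - initial d\<^sub>f $ r)) +
                   (LINT t:{0..T}|lebesgue.
                      (\<Sum>r\<in>UNIV. \<bar>bar_Phi \<Phi> d\<^sub>g G r t - bar_Phi \<Phi> d\<^sub>f F r t\<bar>)
                      + norm1 (inflow d\<^sub>g t - inflow d\<^sub>f t))))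
       \<and> (\<forall>(d :: 'n junction_data) F G.
            admissible_data T d \<longrightarrow>
            mild_solution T v a \<eta>0 A \<Phi> d F \<longrightarrow> mild_solution T v a \<eta>0 A \<Phi> d G \<longrightarrow>
            (\<forall>t\<in>{0..T}. F t = G t))"
proof -
  obtain M where "M \<ge> 1"
    and M: "\<And>d e F G t. \<lbrakk>admissible_data T d; admissible_data T e;
        mild_solution T v a \<eta>0 A \<Phi> d F; mild_solution T v a \<eta>0 A \<Phi> e G; t \<in> {0..T}\<rbrakk> \<Longrightarrow>
      l1_dist (G t) (F t) \<le> l1_dist (initial e) (initial d)
        + M * integral {0..t} (\<lambda>s. l1_dist (G s) (F s))
        + M * integral {0..t} (boundary_dist \<Phi> d e F G)"
    by (rule mild_solutions_integral_inequality[OF assms(4,6,7), of T v \<eta>0]) (rule that)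
  have stability: "sup_norm T (\<lambda>t. G t - F t) \<le> M * exp (M * T)
      * (l1_dist (initial e) (initial d) + (LINT t:{0..T}|lebesgue. boundary_dist \<Phi> d e F G t))"
    if d: "admissible_data T d" and e: "admissible_data T e"
      and mF: "mild_solution T v a \<eta>0 A \<Phi> d F" and mG: "mild_solution T v a \<eta>0 A \<Phi> e G"
    for d e F G
  proof -
    have F: "F \<in> junction_states T" and G: "G \<in> junction_states T"
      using mF mG by (auto simp: mild_solution_def)
    define I where "I = l1_dist (initial e) (initial d)"
    define J where "J = (LINT t:{0..T}|lebesgue. boundary_dist \<Phi> d e F G t)"
    note b = set_lebesgue_integral_eq_integral[OF boundary_dist_integrable[OF d F e G assms(7)]]
    have J: "J = integral {0..T} (boundary_dist \<Phi> d e F G)"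
      using b(2) by (simp add: J_def)
    have "I \<ge> 0" "J \<ge> 0"
      using b(1) by (auto simp: I_def J l1_dist_nonneg boundary_dist_nonneg intro: integral_nonneg)
    have "l1_dist (G t) (F t) \<le> M * exp (M * T) * (I + J)" if t: "t \<in> {0..T}" for t
    proof -
      \<comment> \<open>Gronwall's inequality needs an initial term independent of time, so the
        integral of the nonnegative boundary term is enlarged to all of
        \<open>{0..T}\<close>.\<close>
      have "l1_dist (G t) (F t) \<le> (I + M * J) * exp (M * t)"
      proof (rule gronwall_integral[OF l1_dist_continuous_on[OF G F] _ _ t])
        fix s assume s: "s \<in> {0..T}"
        have "integral {0..s} (boundary_dist \<Phi> d e F G) \<le> J"
          unfolding J using s b(1)
          by (intro integral_subset_le) (auto simp: boundary_dist_nonneg intro: integrable_on_subinterval)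
        then have "M * integral {0..s} (boundary_dist \<Phi> d e F G) \<le> M * J"
          using \<open>M \<ge> 1\<close> by simp
        then show "l1_dist (G s) (F s) \<le> I + M * J + M * integral {0..s} (\<lambda>s. l1_dist (G s) (F s))"
          using M[OF d e mF mG s] by (simp add: I_def)
      qed (use \<open>M \<ge> 1\<close> in simp)
      also have "\<dots> \<le> (M * (I + J)) * exp (M * T)"
      proof (rule mult_mono)
        \<comment> \<open>Here \<open>M \<ge> 1\<close> lets one factor serve both the initial and
          the boundary term.\<close>
        show "I + M * J \<le> M * (I + J)"
          using mult_right_mono[OF \<open>M \<ge> 1\<close> \<open>I \<ge> 0\<close>] by (simp add: algebra_simps)
      qed (use \<open>M \<ge> 1\<close> \<open>I \<ge> 0\<close> \<open>J \<ge> 0\<close> t in auto)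
      finally show ?thesis
        by (simp add: mult_ac)
    qed
    then show ?thesis
      \<comment> \<open>Positivity of \<open>T\<close> makes the interval nonempty, so a uniform
        bound passes to the supremum.\<close>
      unfolding sup_norm_def I_def J_def using \<open>T > 0\<close>
      by (intro cSUP_least) (auto simp: l1_dist_def norm1_def)
  qed
  have uniqueness: "F t = G t"
    if d: "admissible_data T d"
      and mF: "mild_solution T v a \<eta>0 A \<Phi> d F" and mG: "mild_solution T v a \<eta>0 A \<Phi> d G"
      and t: "t \<in> {0..T}"
    for d F G t
  proof -
    have F: "F \<in> junction_states T" and G: "G \<in> junction_states T"
      using mF mG by (auto simp: mild_solution_def)
    obtain L where "L > 0" and L: "\<And>s. s \<in> {0..T} \<Longrightarrow>
        boundary_dist \<Phi> d d F G s \<le> L * l1_dist (G s) (F s)"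
      using boundary_dist_same_data[OF d F G assms(7)] by blast
    note b = set_lebesgue_integral_eq_integral(1)[OF boundary_dist_integrable[OF d F d G assms(7)]]
    note cont = l1_dist_continuous_on[OF G F]
    \<comment> \<open>The initial distance is 0, and the boundary term adds \<open>M * L\<close> to
      the rate \<open>M\<close>.\<close>
    have "l1_dist (G t) (F t) \<le> 0 * exp (M * (1 + L) * t)"
    proof (rule gronwall_integral[OF cont _ _ t])
      fix s assume s: "s \<in> {0..T}"
      have "integral {0..s} (boundary_dist \<Phi> d d F G) \<le> integral {0..s} (\<lambda>u. L * l1_dist (G u) (F u))"
        using s by (intro integral_le integrable_on_subinterval[OF b] integrable_continuous_real
          continuous_on_mult continuous_on_const continuous_on_subset[OF cont] L) auto
      then have "M * integral {0..s} (boundary_dist \<Phi> d d F G)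
          \<le> M * (L * integral {0..s} (\<lambda>u. l1_dist (G u) (F u)))"
        using \<open>M \<ge> 1\<close> by simp
      then show "l1_dist (G s) (F s)
          \<le> 0 + M * (1 + L) * integral {0..s} (\<lambda>u. l1_dist (G u) (F u))"
        using M[OF d d mF mG s] by (simp add: algebra_simps l1_dist_eq_0_iff[THEN iffD2])
    qed (use \<open>M \<ge> 1\<close> \<open>L > 0\<close> in simp)
    then show ?thesis
      using l1_dist_nonneg[of "G t" "F t"] by (simp add: l1_dist_eq_0_iff)
  qed
  show ?thesis
    using stability uniqueness \<open>M \<ge> 1\<close>
    unfolding l1_dist_def boundary_dist_def
    by (intro conjI exI[of _ "M * exp (M * T)"]) auto
qed

end
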